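(* If $p$ is a prime number with $p>3$ and $n\in\mathbb{N}$, then $p^n$ is complete.
   Context: Let $\mu$ be the unique Borel probability measure on $\mathbb{R}$ satisfying $\mu(E)=\frac12\left(\mu(\tau_0^{-1}E)+\mu(\tau_2^{-1}E)\right)$ for all Borel sets $E$, where $\tau_0(x)=x/4$, $\tau_2(x)=(x+2)/4$. For odd $m\in\mathbb{N}$ let $\Gamma(m)=\{\sum_{k=0}^n 4^k l_k : l_k\in\{0,m\}, n\in\mathbb{N}\}$; $m$ is complete if $\{e^{2\pi i\lambda x}:\lambda\in\Gamma(m)\}$ is an orthonormal basis of $L^2(\mu)$, incomplete otherwise. (Known fact from prior work: $m$ is complete iff the only extreme cycle for the digits $\{0,m\}$ is $\{0\}$, where a finite set $\{x_0,\dots,x_{r-1}\}\subset\mathbb{R}$ is an extreme cycle for $\{0,m\}$ if there are $l_0,\dots,l_{r-1}\in\{0,m\}$ with $x_{k+1}=(x_k+l_k)/4$ for $0\le k\le r-2$, $x_0=(x_{r-1}+l_{r-1})/4$, and $\left|\frac{1+e^{2\pi i\cdot 2x_k}}{2}\right|=1$ for all $k$.) *)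

theory Defs
  imports "HOL-Probability.Probability"
begin

definition tau0 :: "real \<Rightarrow> real" where
  "tau0 x = x / 4"

definition tau2 :: "real \<Rightarrow> real" where
  "tau2 x = (x + 2) / 4"

text \<open>
  The predicate characterizes the measure $\mu$ uniquely (Hutchinson), so a statement about every
  measure satisfying it is a statement about $\mu$. That such a measure exists is proved at the end
  of this theory.
\<close>

definition invariant_measure :: "real measure \<Rightarrow> bool" where
  "invariant_measure \<mu> \<longleftrightarrow>
     prob_space \<mu> \<and> sets \<mu> = sets borel \<and>
     (\<forall>E \<in> sets borel.
        measure \<mu> E = (measure \<mu> (tau0 -` E) + measure \<mu> (tau2 -` E)) / 2)"

text \<open>
  Elements of $L^2(M)$ are represented by functions; functions that agree almost everywhere are not
  identified, and all notions below are insensitive to changes on null sets.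
\<close>

definition square_integrable :: "'a measure \<Rightarrow> ('a \<Rightarrow> complex) \<Rightarrow> bool" where
  "square_integrable M f \<longleftrightarrow>
     f \<in> borel_measurable M \<and> integrable M (\<lambda>x. (norm (f x))\<^sup>2)"

definition L2_inner :: "'a measure \<Rightarrow> ('a \<Rightarrow> complex) \<Rightarrow> ('a \<Rightarrow> complex) \<Rightarrow> complex" where
  "L2_inner M f g = (LINT x|M. f x * cnj (g x))"

definition L2_norm :: "'a measure \<Rightarrow> ('a \<Rightarrow> complex) \<Rightarrow> real" where
  "L2_norm M f = sqrt (LINT x|M. (norm (f x))\<^sup>2)"

text \<open>
  An orthonormal basis of the Hilbert space $L^2(M)$: an orthonormal family whose finite linear
  combinations are dense.
\<close>

definition orthonormal_basis_L2 :: "'a measure \<Rightarrow> 'i set \<Rightarrow> ('i \<Rightarrow> 'a \<Rightarrow> complex) \<Rightarrow> bool" where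
  "orthonormal_basis_L2 M I e \<longleftrightarrow>
     (\<forall>i\<in>I. square_integrable M (e i)) \<and>
     (\<forall>i\<in>I. \<forall>j\<in>I. L2_inner M (e i) (e j) = (if i = j then 1 else 0)) \<and>
     (\<forall>f. square_integrable M f \<longrightarrow>
        (\<forall>\<epsilon>>0. \<exists>F c. finite F \<and> F \<subseteq> I \<and>
           L2_norm M (\<lambda>x. f x - (\<Sum>i\<in>F. c i * e i x)) < \<epsilon>))"

definition Gamma_set :: "nat \<Rightarrow> nat set" where
  "Gamma_set m = {\<Sum>k=0..n. 4 ^ k * l k | (l :: nat \<Rightarrow> nat) n. \<forall>k\<le>n. l k \<in> {0, m}}"

definition complete_number :: "real measure \<Rightarrow> nat \<Rightarrow> bool" where
  "complete_number \<mu> m \<longleftrightarrow>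
     orthonormal_basis_L2 \<mu> (Gamma_set m)
       (\<lambda>\<gamma> x. exp (2 * of_real pi * \<i> * of_nat \<gamma> * of_real x))"

text \<open>
  Existence: the law of $\sum_n d_n 4^{-(n+1)}$ for independent digits $d_n$ uniform on $\{0,2\}$.
\<close>

lemma invariant_measure_exists: "\<exists>\<mu>. invariant_measure \<mu>"
proof -
  define B where "B = measure_pmf (pmf_of_set (UNIV :: bool set))"
  define S where "S = stream_space B"
  define dg where "dg = (\<lambda>b::bool. if b then 2 else 0 :: real)"
  define X where "X = (\<lambda>s. \<Sum>n. dg (s !! n) / 4 ^ (n + 1))"
  interpret B: prob_space B unfolding B_def by (rule measure_pmf.prob_space_axioms)
  interpret S: prob_space S unfolding S_def by (rule B.prob_space_stream_space)
  have [measurable]: "dg \<in> borel_measurable B" unfolding B_def by simp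
  have [measurable]: "X \<in> borel_measurable S"
    unfolding X_def S_def by measurable
  have summ: "summable (\<lambda>n. dg (s !! n) / 4 ^ (n + 1))" for s
  proof (rule summable_comparison_test')
    show "summable (\<lambda>n. 2 * (1 / 4 :: real) ^ n)"
      by (intro summable_mult summable_geometric) simp
    show "norm (dg (s !! n) / 4 ^ (n + 1)) \<le> 2 * (1 / 4) ^ n" if "n \<ge> 0" for n
      by (simp add: dg_def field_simps)
  qed
  have step: "X (b ## s) = (X s + dg b) / 4" for b s
  proof -
    have "X (b ## s) = (\<Sum>n. dg ((b ## s) !! Suc n) / 4 ^ (Suc n + 1)) + dg b / 4"
      unfolding X_def by (subst suminf_split_head[OF summ]) simp
    also have "(\<Sum>n. dg ((b ## s) !! Suc n) / 4 ^ (Suc n + 1)) = X s / 4"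
      unfolding X_def by (subst suminf_divide[OF summ, symmetric]) (simp add: field_simps)
    finally show ?thesis by (simp add: field_simps)
  qed
  define \<mu> where "\<mu> = distr S borel X"
  have ps: "prob_space \<mu>" unfolding \<mu>_def by (rule S.prob_space_distr) simp
  interpret mu: prob_space \<mu> by (rule ps)
  have inv: "measure \<mu> E = (measure \<mu> (tau0 -` E) + measure \<mu> (tau2 -` E)) / 2"
    if [measurable]: "E \<in> sets borel" for E
  proof -
    have [measurable]: "tau0 \<in> borel_measurable borel" "tau2 \<in> borel_measurable borel"
      unfolding tau0_def[abs_def] tau2_def[abs_def] by measurable
    have sp: "space S = UNIV" unfolding S_def B_def by (simp add: space_stream_space)
    have t: "tau0 -` E \<in> sets borel" "tau2 -` E \<in> sets borel"
      using measurable_sets[of tau0 borel borel E] measurable_sets[of tau2 borel borel E] by auto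
    have mE: "X -` E \<in> sets S" using measurable_sets[of X S borel E] sp by simp
    have m0: "X -` tau0 -` E \<in> sets S" "X -` tau2 -` E \<in> sets S"
      using measurable_sets[of X S borel] sp t by auto
    have v: "(##) b -` X -` E = (if b then X -` tau2 -` E else X -` tau0 -` E)" for b
      by (auto simp: step tau0_def tau2_def dg_def)
    have "emeasure S (X -` E) = (\<integral>\<^sup>+b. emeasure S ((##) b -` X -` E) \<partial>B)"
      using B.emeasure_stream_space[of "X -` E"] mE sp unfolding S_def
      by (simp add: vimage_def space_stream_space B_def)
    also have "\<dots> = (emeasure S (X -` tau0 -` E) + emeasure S (X -` tau2 -` E)) / 2"
      unfolding B_def v
      by (subst nn_integral_pmf_of_set) (auto simp: UNIV_bool add.commute)
    also have "\<dots> = ennreal ((measure S (X -` tau0 -` E) + measure S (X -` tau2 -` E)) / 2)"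
      by (simp add: S.emeasure_eq_measure divide_ennreal flip: ennreal_plus ennreal_numeral)
    finally have "measure S (X -` E) = (measure S (X -` tau0 -` E) + measure S (X -` tau2 -` E)) / 2"
      by (intro measure_eq_emeasure_eq_ennreal) simp_all
    then show ?thesis
      unfolding \<mu>_def using t sp by (simp add: measure_distr)
  qed
  have "sets \<mu> = sets borel" unfolding \<mu>_def by simp
  then show ?thesis using ps inv unfolding invariant_measure_def by blast
qed

end

theory Submission
  imports Defs "HOL-Number_Theory.Number_Theory"
begin

text \<open>
  Let \<open>h t\<close> be the sum of \<open>(norm (mu_hat (t + l)))\<^sup>2\<close> over \<open>l \<in> Gamma_set m\<close>, where \<open>mu_hat\<close> is the Fourier
  transform of \<open>\<mu>\<close>. Since \<open>Gamma_set m\<close> is the disjoint union of \<open>4 * Gamma_set m\<close> and \<open>4 * Gamma_set m + m\<close>,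
  the refinement equation \<open>mu_hat t = (1 + cis (pi * t)) / 2 * mu_hat (t / 4)\<close> makes \<open>h\<close> a fixed point of a
  transfer operator that averages \<open>h (t / 4)\<close> and \<open>h ((t + m) / 4)\<close>. If \<open>h\<close> is not constantly 1, its minimum
  points on a large interval are nonzero integers forming extreme cycles. For \<open>m = p ^ n\<close> there are none:
  one of \<open>2\<close>, \<open>-1\<close>, \<open>-2\<close> is a power of 4 modulo \<open>m\<close>. So \<open>h\<close> is 1, which by Parseval puts every exponential
  into the closed span of the family, and the exponentials are total by the Stone-Weierstrass theorem because
  \<open>\<mu>\<close> has bounded support.
\<close>

section \<open>Powers of 4 modulo a prime power\<close>

text \<open>An odd prime cannot divide both \<open>x - 1\<close> and \<open>x + 1\<close>, which
  differ by 2. So one factor of \<open>x\<^sup>2 - 1\<close> is coprime to \<open>p ^ n\<close>, and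
  the other carries the whole power.\<close>

lemma square_root_of_unity_mod_prime_power:
  fixes x :: int and p :: nat
  assumes "prime p" "odd p" "[x\<^sup>2 = 1] (mod int (p ^ n))"
  shows "[x = 1] (mod int (p ^ n)) \<or> [x = -1] (mod int (p ^ n))"
proof -
  have pr: "prime (int p)" using assms by simp
  have d: "int p ^ n dvd (x - 1) * (x + 1)"
    using assms(3) by (simp add: cong_iff_dvd_diff power2_eq_square algebra_simps)
  have "\<not> (int p dvd x - 1 \<and> int p dvd x + 1)"
  proof
    assume "int p dvd x - 1 \<and> int p dvd x + 1"
    then have "int p dvd (x + 1) - (x - 1)" by (meson dvd_diff)
    then have "p dvd 2" by (simp flip: int_dvd_int_iff)
    then show False using assms(1,2) by (metis dvd_antisym odd_two_times_div_two_nat primes_dvd_imp_eq two_is_prime_nat even_numeral dvd_refl)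
  qed
  then have "coprime (int p ^ n) (x - 1) \<or> coprime (int p ^ n) (x + 1)"
    using pr by (meson prime_imp_coprime coprime_power_left_iff)
  then show ?thesis
    using d by (auto simp: cong_iff_dvd_diff coprime_dvd_mult_left_iff coprime_dvd_mult_right_iff)
qed

text \<open>If \<open>r\<close> is the order of 4 then \<open>2 ^ r\<close> is a square root of 1, so it is \<open>1\<close> or \<open>-1\<close>;
  the parity of \<open>r\<close> decides the case.\<close>

lemma power_of_four_mod_prime_power:
  fixes p n :: nat
  assumes "prime p" "odd p"
  shows "\<exists>k. [4 ^ k = 2] (mod int (p ^ n)) \<or> [4 ^ k = -1] (mod int (p ^ n))
    \<or> [4 ^ k = -2] (mod int (p ^ n))"
proof -
  let ?m = "int (p ^ n)"
  define P where "P = (\<lambda>r. r > 0 \<and> [4 ^ r = 1] (mod ?m))"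
  have "coprime 4 (p ^ n)"
    using assms by (metis coprime_left_2_iff_odd coprime_mult_left_iff mult_2 numeral_Bit0 coprime_power_right_iff)
  then have "[4 ^ totient (p ^ n) = 1] (mod (p ^ n))" by (rule euler_theorem)
  then have "[4 ^ totient (p ^ n) = 1] (mod ?m)"
    by (metis cong_int_iff of_nat_1 of_nat_numeral of_nat_power)
  moreover have "totient (p ^ n) > 0" using assms(1) by (simp add: prime_gt_0_nat)
  ultimately have "P (totient (p ^ n))" by (simp add: P_def)
  then obtain r where r: "P r" and min: "\<And>s. P s \<Longrightarrow> r \<le> s"
    by (metis LeastI Least_le)
  have "[(2 ^ r)\<^sup>2 = 1] (mod ?m)"
    using r unfolding P_def power_mult[symmetric] mult.commute[of r 2] by (simp add: power_mult)
  from square_root_of_unity_mod_prime_power[OF assms this]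
  consider "[2 ^ r = 1] (mod ?m)" | "[2 ^ r = -1] (mod ?m)" by blast
  then show ?thesis
  proof cases
    case 1
    \<comment> \<open>For \<open>r = 2 * s\<close> the case assumption reads
      \<open>4 ^ s = 1\<close>, against the minimality of \<open>r\<close>.\<close>
    have "odd r"
    proof
      assume "even r"
      then obtain s where s: "r = 2 * s" by blast
      then have "P s" using r 1 by (simp add: P_def power_mult)
      then show False using min[of s] s r by (simp add: P_def)
    qed
    then obtain s where s: "r = 2 * s + 1" by (meson oddE)
    \<comment> \<open>For odd \<open>r\<close> one more factor 2 makes the exponent even, so the
      left side is a power of 4.\<close>
    have "[2 * 2 ^ r = 2 * 1] (mod ?m)" using 1 by (intro cong_mult cong_refl)
    moreover have "2 * 2 ^ r = (4 :: int) ^ (s + 1)" by (simp add: s power_mult)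
    ultimately show ?thesis by (metis mult_1_right)
  next
    case 2
    show ?thesis
    proof (cases "even r")
      case True
      then obtain s where "r = 2 * s" by blast
      then show ?thesis using 2 by (auto simp: power_mult)
    next
      case False
      then obtain s where s: "r = 2 * s + 1" by (meson oddE)
      have "[2 * 2 ^ r = 2 * -1] (mod ?m)" using 2 by (intro cong_mult cong_refl)
      moreover have "2 * 2 ^ r = (4 :: int) ^ (s + 1)" by (simp add: s power_mult)
      ultimately show ?thesis by (metis mult_minus1_right)
    qed
  qed
qed

text \<open>The elements of \<open>S\<close> in \<open>(0, m / 3]\<close> form a nonempty set that is stable under division by 4
  modulo \<open>m = p ^ n\<close>, hence under division by 2, by \<open>-1\<close> or by \<open>-2\<close>; each is impossible in so short
  an interval.\<close>

lemma no_integer_extreme_cycle: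
  fixes p n :: nat and S :: "int set"
  assumes p: "prime p" "p > 3"
    and S: "0 \<notin> S"
    and step: "\<And>x. x \<in> S \<Longrightarrow> \<exists>y\<in>S. 4 * y = x \<or> 4 * y = x + int (p ^ n)"
  shows "S = {}"
proof (rule ccontr)
  assume "S \<noteq> {}"
  define m where "m = int (p ^ n)"
  have m: "m > 0" using p by (simp add: m_def prime_gt_0_nat)
  have p_odd: "odd p" using p prime_odd_nat by auto
  have "coprime 3 p" using p by (intro primes_coprime) auto
  then have "coprime 3 (p ^ n)" by simp
  then have m3: "\<not> 3 dvd m"
    unfolding m_def using coprime_common_divisor_nat[of 3 "p ^ n" 3] int_dvd_int_iff[of 3 "p ^ n"] by auto
  define S' where "S' = {x \<in> S. 0 < x \<and> 3 * x \<le> m}"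
  \<comment> \<open>three times the distance to \<open>[0, m / 3]\<close>, which the step divides by 4\<close>
  define d where "d = (\<lambda>x. nat (max 0 (max (- 3 * x) (3 * x - m))))"
  have ne: "S' \<noteq> {}"
  proof -
    obtain x where x: "x \<in> S" and min: "\<And>y. y \<in> S \<Longrightarrow> d x \<le> d y"
      using ex_has_least_nat[of "\<lambda>x. x \<in> S" _ d] \<open>S \<noteq> {}\<close> by blast
    obtain y where y: "y \<in> S" "4 * y = x \<or> 4 * y = x + m"
      using step[OF x] m_def by blast
    have "x \<noteq> 0" using S x by auto
    \<comment> \<open>The least value of \<open>d\<close> must be 0: a positive value at
      \<open>x\<close> would be strictly larger than the value at \<open>y\<close>.\<close>
    then have "0 < x \<and> 3 * x \<le> m"
      using min[OF y(1)] y(2) m unfolding d_def by linarith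
    then show ?thesis using x unfolding S'_def by blast
  qed
  have step': "\<exists>y\<in>S'. [4 * y = x] (mod m)" if x: "x \<in> S'" for x
  proof -
    obtain y where y: "y \<in> S" "4 * y = x \<or> 4 * y = x + m"
      using step[of x] x unfolding S'_def m_def by blast
    \<comment> \<open>The bound \<open>m / 3\<close> is the fixed point of the move from
      \<open>x\<close> to \<open>(x + m) / 4\<close>, so neither move leaves the interval.\<close>
    then have "y \<in> S'" using x m by (auto simp: S'_def)
    moreover have "[4 * y = x] (mod m)" using y(2) by (auto simp: cong_def)
    ultimately show ?thesis by blast
  qed
  have iter: "\<exists>y\<in>S'. [4 ^ k * y = x] (mod m)" if "x \<in> S'" for k x
    using that
  proof (induction k arbitrary: x)
    case 0
    then show ?case by (intro bexI[of _ x]) auto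
  next
    case (Suc k)
    then obtain z where z: "z \<in> S'" "[4 * z = x] (mod m)" using step' by blast
    obtain y where y: "y \<in> S'" "[4 ^ k * y = z] (mod m)" using Suc.IH z by blast
    have "[4 * (4 ^ k * y) = 4 * z] (mod m)" using y by (intro cong_mult cong_refl)
    then show ?case using y z by (auto simp: mult.assoc intro: cong_trans)
  qed
  obtain k where k: "[4 ^ k = 2] (mod m) \<or> [4 ^ k = -1] (mod m) \<or> [4 ^ k = -2] (mod m)"
    using power_of_four_mod_prime_power[OF p(1) p_odd] unfolding m_def by blast
  have small: "a = 0" if "[a = 0] (mod m)" "\<bar>a\<bar> < m" for a
    using that dvd_imp_le_int[of a m] by (auto simp: cong_0_iff)
  \<comment> \<open>Minimality serves the case \<open>4 ^ k = 2\<close>: there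
    \<open>x = 2 * y\<close>, so \<open>y\<close> would be a smaller element of \<open>S'\<close>.
    In the other cases the signs of \<open>x\<close> and \<open>y\<close> contradict.\<close>
  obtain x where x: "x \<in> S'" and xmin: "\<And>y. y \<in> S' \<Longrightarrow> nat x \<le> nat y"
    using ex_has_least_nat[of "\<lambda>x. x \<in> S'" _ nat] ne by blast
  obtain y where y: "y \<in> S'" "[4 ^ k * y = x] (mod m)" using iter[OF x] by blast
  have b: "0 < x" "3 * x \<le> m" "0 < y" "3 * y \<le> m" using x y unfolding S'_def by auto
  have c: "[c * y - x = 0] (mod m)" if "[4 ^ k = c] (mod m)" for c
  proof -
    have "[c * y = 4 ^ k * y] (mod m)" using that by (intro cong_mult cong_refl) (rule cong_sym)
    then show ?thesis using y(2) by (simp add: cong_diff_iff_cong_0 cong_trans)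
  qed
  from k consider "[2 * y - x = 0] (mod m)" | "[-1 * y - x = 0] (mod m)" | "[-2 * y - x = 0] (mod m)"
    using c by blast
  then show False
  proof cases
    case 1
    then have "2 * y - x = 0" using b by (intro small) auto
    then show False using xmin[OF y(1)] b by linarith
  next
    case 2
    then have "-1 * y - x = 0" using b by (intro small) auto
    then show False using b by linarith
  next
    case 3
    have "\<bar>-2 * y - x\<bar> < m"
    proof -
      \<comment> \<open>Both \<open>3 * x\<close> and \<open>3 * y\<close> are at most
        \<open>m\<close>, so \<open>2 * y + x = m\<close> would force \<open>3 * x = m\<close>; a
        power of a prime above 3 is not divisible by 3.\<close>
      have "3 * x \<noteq> m" using m3 by auto
      then show ?thesis using b by auto
    qed
    then have "-2 * y - x = 0" by (intro small 3)
    then show False using b by linarith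
  qed
qed

section \<open>The transfer operator\<close>

text \<open>The weights are the squared moduli of \<open>(1 + cis (pi * t)) / 2\<close> and, as \<open>m\<close> is odd, of
  \<open>(1 + cis (pi * (t + m))) / 2\<close>.\<close>

definition transfer :: "nat \<Rightarrow> (real \<Rightarrow> real) \<Rightarrow> real \<Rightarrow> real" where
  "transfer m h t = (1 + cos (pi * t)) / 2 * h (t / 4) + (1 - cos (pi * t)) / 2 * h ((t + real m) / 4)"

lemma transfer_mono:
  assumes "\<And>t. g t \<le> h t"
  shows "transfer m g t \<le> transfer m h t"
proof -
  have "0 \<le> 1 + cos (pi * t)" using cos_ge_minus_one[of "pi * t"] by linarith
  then show ?thesis using assms by (auto simp: transfer_def intro!: add_mono mult_left_mono)
qed

lemma transfer_le_one:
  assumes "\<And>t. h t \<le> 1"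
  shows "transfer m h t \<le> 1"
proof -
  have "transfer m h t \<le> transfer m (\<lambda>_. 1) t" using assms by (rule transfer_mono)
  then show ?thesis by (simp add: transfer_def field_simps)
qed

text \<open>A pointwise limit from below of continuous functions is lower semicontinuous, which is
  enough for a minimum on a compact set. It will be applied to a limit of partial sums, whose
  continuity is not known.\<close>

lemma sup_of_continuous_attains_inf:
  fixes K :: "real set" and H :: "real \<Rightarrow> real"
  assumes K: "compact K" "K \<noteq> {}"
    and h: "\<And>n. continuous_on K (h n)" "\<And>n t. h n t \<le> H t" "\<And>t. (\<lambda>n. h n t) \<longlonglongrightarrow> H t"
  shows "\<exists>t\<in>K. \<forall>s\<in>K. H t \<le> H s"
proof -
  obtain b where "\<And>s. s \<in> K \<Longrightarrow> h 0 b \<le> h 0 s"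
    using continuous_attains_inf[OF K h(1)] by blast
  then have bdd: "bdd_below (H ` K)"
    by (intro bdd_belowI2[of _ "h 0 b"]) (meson h(2) order_trans)
  define c where "c = Inf (H ` K)"
  have "\<exists>t\<in>K. H t < c + 1 / real (Suc n)" for n
    using cInf_lessD[of "H ` K" "c + 1 / real (Suc n)"] K(2) by (auto simp: c_def)
  then obtain u where u: "\<And>n. u n \<in> K" "\<And>n. H (u n) < c + 1 / real (Suc n)" by metis
  obtain t r where t: "t \<in> K" and r: "strict_mono r" "(u \<circ> r) \<longlonglongrightarrow> t"
    using K(1) u(1) unfolding compact_def by metis
  \<comment> \<open>Along the minimizing subsequence \<open>h j\<close> stays below
    \<open>H\<close>, whose values approach \<open>c\<close>; continuity of the single function
    \<open>h j\<close> carries the bound to \<open>t\<close>.\<close>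
  have "h j t \<le> c" for j
  proof (rule LIMSEQ_le)
    show "(\<lambda>n. h j (u (r n))) \<longlonglongrightarrow> h j t"
      using continuous_on_tendsto_compose[OF h(1) r(2) t] u(1) by (simp add: comp_def)
    have "(\<lambda>n. c + 1 / real (Suc n)) \<longlonglongrightarrow> c + 0"
      by (intro tendsto_intros LIMSEQ_Suc lim_1_over_n)
    from LIMSEQ_subseq_LIMSEQ[OF this r(1)]
    show "(\<lambda>n. c + 1 / real (Suc (r n))) \<longlonglongrightarrow> c" by (simp add: comp_def)
    show "\<exists>N. \<forall>n\<ge>N. h j (u (r n)) \<le> c + 1 / real (Suc (r n))"
      by (meson h(2) u(2) less_imp_le order_trans)
  qed
  then have "H t \<le> c" by (intro LIMSEQ_le_const2[OF h(3)]) auto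
  then have "\<forall>s\<in>K. H t \<le> H s"
    unfolding c_def using cInf_lower[OF _ bdd] by (meson imageI order_trans)
  then show ?thesis using t by blast
qed

text \<open>The weight of the move to \<open>t / 4\<close> vanishes only at odd integers. Hence a
  point that is not a nonzero integer can be divided by 4 forever, always with positive
  weight.\<close>

lemma cos_eq_minus_one_at_scale_imp_int:
  assumes "cos (pi * (t / 4 ^ k)) = -1"
  shows "\<exists>x::int. x \<noteq> 0 \<and> t = of_int x"
proof -
  obtain i :: int where "pi * (t / 4 ^ k) = (2 * real_of_int i + 1) * pi"
    using assms cos_eq_minus1 by blast
  then have "pi * (t / 4 ^ k) = pi * real_of_int (2 * i + 1)" by (simp add: mult.commute)
  then have "t / 4 ^ k = real_of_int (2 * i + 1)" by (simp only: mult_left_cancel[OF pi_neq_zero])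
  then have "t = real_of_int ((2 * i + 1) * 4 ^ k)" by (simp add: field_simps)
  moreover have "(2 * i + 1) * 4 ^ k \<noteq> 0" by (simp; presburger)
  ultimately show ?thesis by blast
qed

text \<open>The set of minimum points of \<open>H\<close> on a large interval is stable under every move of positive
  weight. A minimum point all of whose quotients by powers of 4 are reachable leads to 0, where \<open>H\<close> is 1;
  the other ones are nonzero integers, and \<open>no_cycle\<close> excludes them.\<close>

lemma transfer_fixed_point_eq_one:
  assumes fixed: "\<And>t. H t = transfer m H t"
    and le: "\<And>t. H t \<le> 1"
    and h: "\<And>n. continuous_on UNIV (h n)" "\<And>n t. h n t \<le> H t" "\<And>t. (\<lambda>n. h n t) \<longlonglongrightarrow> H t"
    and h0: "h 0 0 = 1"
    and no_cycle: "\<And>S. 0 \<notin> S \<Longrightarrow>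
      (\<And>x::int. x \<in> S \<Longrightarrow> \<exists>y\<in>S. 4 * y = x \<or> 4 * y = x + int m) \<Longrightarrow> S = {}"
  shows "H t = 1"
proof (rule ccontr)
  assume "H t \<noteq> 1"
  then have Ht: "H t < 1" using le[of t] by simp
  \<comment> \<open>The interval from \<open>-a\<close> to \<open>a\<close> contains
    \<open>t\<close>, and \<open>m <= a\<close> makes both moves map it into itself.\<close>
  define a where "a = max \<bar>t\<bar> (real m)"
  have a: "t \<in> {-a..a}" "real m \<le> a" "0 \<le> a" by (auto simp: a_def)
  obtain t0 where t0: "t0 \<in> {-a..a}" "\<And>s. s \<in> {-a..a} \<Longrightarrow> H t0 \<le> H s"
    using sup_of_continuous_attains_inf[of "{-a..a}" h H] h a continuous_on_subset[OF h(1)] by auto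
  define M where "M = {s \<in> {-a..a}. H s = H t0}"
  have c1: "H t0 < 1" using t0(2)[OF a(1)] Ht by simp
  have move: "(cos (pi * s) \<noteq> -1 \<longrightarrow> s / 4 \<in> M) \<and> (cos (pi * s) \<noteq> 1 \<longrightarrow> (s + m) / 4 \<in> M)"
    if s: "s \<in> M" for s
  proof -
    let ?w = "(1 + cos (pi * s)) / 2"
    have K: "s / 4 \<in> {-a..a}" "(s + m) / 4 \<in> {-a..a}" using s a by (auto simp: M_def)
    have ge: "H t0 \<le> H (s / 4)" "H t0 \<le> H ((s + m) / 4)" using t0(2) K by auto
    \<comment> \<open>The minimum is a convex combination of two values that are no smaller, so each
      excess with positive weight is 0.\<close>
    have eq: "?w * (H (s / 4) - H t0) + (1 - ?w) * (H ((s + m) / 4) - H t0) = 0"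
      using fixed[of s] s by (simp add: M_def transfer_def field_simps)
    have w: "0 \<le> ?w" "0 \<le> 1 - ?w"
      using cos_ge_minus_one[of "pi * s"] cos_le_one[of "pi * s"] by argo+
    have "0 \<le> ?w * (H (s / 4) - H t0)" "0 \<le> (1 - ?w) * (H ((s + m) / 4) - H t0)"
      using w ge by (intro mult_nonneg_nonneg; simp)+
    then have z: "?w * (H (s / 4) - H t0) = 0" "(1 - ?w) * (H ((s + m) / 4) - H t0) = 0"
      using eq by linarith+
    have "1 - ?w \<noteq> 0" if "cos (pi * s) \<noteq> 1" using that by simp
    then show ?thesis using z K unfolding mult_eq_0_iff M_def by auto
  qed
  have int: "\<exists>x::int. x \<noteq> 0 \<and> s = of_int x" if s: "s \<in> M" for s
  proof (rule ccontr)
    assume "\<not> ?thesis"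
    then have nc: "cos (pi * (s / 4 ^ k)) \<noteq> -1" for k
      using cos_eq_minus_one_at_scale_imp_int by blast
    have inM: "s / 4 ^ k \<in> M" for k
    proof (induction k)
      case (Suc k)
      then show ?case using move[OF Suc] nc[of k] by (simp add: field_simps)
    qed (use s in simp)
    have "(\<lambda>k. s * (1 / 4) ^ k) \<longlonglongrightarrow> s * 0" by (intro tendsto_intros LIMSEQ_realpow_zero) auto
    then have "(\<lambda>k. s / 4 ^ k) \<longlonglongrightarrow> 0" by (simp add: power_one_over)
    then have "(\<lambda>k. h 0 (s / 4 ^ k)) \<longlonglongrightarrow> h 0 0"
      by (rule continuous_on_tendsto_compose[OF h(1)]) auto
    then have "h 0 0 \<le> H t0"
      by (rule LIMSEQ_le_const2) (use inM h(2) in \<open>auto simp: M_def intro!: exI[of _ 0], metis\<close>)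
    then show False using h0 c1 by simp
  qed
  define S where "S = {x::int. real_of_int x \<in> M}"
  have "S = {}"
  proof (rule no_cycle)
    show "0 \<notin> S" using int by (force simp: S_def)
    fix x assume "x \<in> S"
    then have x: "real_of_int x \<in> M" by (simp add: S_def)
    \<comment> \<open>The two weights cannot vanish together, so some move stays in
      \<open>M\<close>; by \<open>int\<close> it ends at an integer again.\<close>
    have "real_of_int x / 4 \<in> M \<or> (real_of_int x + m) / 4 \<in> M"
      using move[OF x] by (cases "cos (pi * x) = -1") auto
    then show "\<exists>y\<in>S. 4 * y = x \<or> 4 * y = x + int m"
    proof
      assume *: "real_of_int x / 4 \<in> M"
      then obtain y :: int where y: "real_of_int x / 4 = y" using int by blast
      then have "4 * y = x" by linarith
      then show ?thesis using * y by (auto simp: S_def)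
    next
      assume *: "(real_of_int x + m) / 4 \<in> M"
      then obtain y :: int where y: "(real_of_int x + m) / 4 = y" using int by blast
      then have "real_of_int (4 * y) = real_of_int (x + int m)" by simp
      then have "4 * y = x + int m" by (simp only: of_int_eq_iff)
      then show ?thesis using * y by (auto simp: S_def)
    qed
  qed
  moreover obtain x :: int where "t0 = x" using int[of t0] t0(1) by (auto simp: M_def)
  ultimately show False using t0(1) by (auto simp: S_def M_def)
qed

section \<open>The spectrum\<close>

text \<open>The elements of \<open>Gamma_set m\<close> with \<open>n\<close> digits. Each step
  inserts a new lowest digit, which is the digit that the refinement equation of
  \<open>mu_hat\<close> splits off.\<close>

fun partial_spectrum :: "nat \<Rightarrow> nat \<Rightarrow> nat set" where
  "partial_spectrum m 0 = {0}"
| "partial_spectrum m (Suc n) =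
     (\<lambda>x. 4 * x) ` partial_spectrum m n \<union> (\<lambda>x. 4 * x + m) ` partial_spectrum m n"

lemma partial_spectrum_Suc_iff:
  "x \<in> partial_spectrum m (Suc n) \<longleftrightarrow> (\<exists>y\<in>partial_spectrum m n. \<exists>e\<in>{0, m}. x = 4 * y + e)"
  by auto

lemma finite_partial_spectrum [simp]: "finite (partial_spectrum m n)"
  by (induction n) auto

declare partial_spectrum.simps(2) [simp del]

lemma partial_spectrum_mono: "n \<le> k \<Longrightarrow> partial_spectrum m n \<subseteq> partial_spectrum m k"
proof (rule lift_Suc_mono_le[of "partial_spectrum m"])
  show "partial_spectrum m j \<subseteq> partial_spectrum m (Suc j)" for j
  proof (induction j)
    case (Suc j)
    then show ?case unfolding partial_spectrum.simps(2) by (intro Un_mono image_mono)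
  qed (simp add: partial_spectrum.simps(2))
qed

text \<open>A sum up to index \<open>n\<close> has \<open>n + 1\<close> digits, hence
  \<open>Suc n\<close> on the left. Splitting off \<open>l 0\<close> and shifting the other digits
  turns the sum into the recursion.\<close>

lemma partial_spectrum_eq_sums:
  "partial_spectrum m (Suc n) = {\<Sum>k=0..n. 4 ^ k * l k | l. \<forall>k\<le>n. l k \<in> {0, m}}"
proof (induction n)
  case 0
  show ?case
  proof (intro equalityI subsetI)
    fix x assume "x \<in> partial_spectrum m (Suc 0)"
    then have "x = 0 \<or> x = m" by (auto simp: partial_spectrum_Suc_iff)
    then show "x \<in> {\<Sum>k=0..0. 4 ^ k * l k | l. \<forall>k\<le>0. l k \<in> {0, m}}"
      by (intro CollectI exI[of _ "\<lambda>_. x"]) auto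
  qed (auto simp: partial_spectrum_Suc_iff)
next
  case (Suc n)
  have split: "(\<Sum>k=0..Suc n. 4 ^ k * l k) = 4 * (\<Sum>k=0..n. 4 ^ k * l (Suc k)) + l 0" for l :: "nat \<Rightarrow> nat"
    by (subst sum.atLeast0_atMost_Suc_shift) (simp add: sum_distrib_left mult.assoc)
  show ?case
  proof (intro equalityI subsetI)
    fix x assume "x \<in> partial_spectrum m (Suc (Suc n))"
    then obtain y e where y: "y \<in> partial_spectrum m (Suc n)" "e \<in> {0, m}" "x = 4 * y + e"
      unfolding partial_spectrum_Suc_iff[of x m "Suc n"] by blast
    then obtain l where l: "\<forall>k\<le>n. l k \<in> {0, m}" "y = (\<Sum>k=0..n. 4 ^ k * l k)"
      using Suc by auto
    have "x = (\<Sum>k=0..Suc n. 4 ^ k * (case k of 0 \<Rightarrow> e | Suc i \<Rightarrow> l i))"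
      unfolding split using y l by simp
    moreover have "\<forall>k\<le>Suc n. (case k of 0 \<Rightarrow> e | Suc i \<Rightarrow> l i) \<in> {0, m}"
      using y l by (auto split: nat.split)
    ultimately show "x \<in> {\<Sum>k=0..Suc n. 4 ^ k * l k | l. \<forall>k\<le>Suc n. l k \<in> {0, m}}" by blast
  next
    fix x assume "x \<in> {\<Sum>k=0..Suc n. 4 ^ k * l k | l. \<forall>k\<le>Suc n. l k \<in> {0, m}}"
    then obtain l where l: "\<forall>k\<le>Suc n. l k \<in> {0, m}" "x = 4 * (\<Sum>k=0..n. 4 ^ k * l (Suc k)) + l 0"
      unfolding split by blast
    have "\<forall>k\<le>n. l (Suc k) \<in> {0, m}" using l(1) by simp
    then have "(\<Sum>k=0..n. 4 ^ k * l (Suc k)) \<in> partial_spectrum m (Suc n)"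
      unfolding Suc mem_Collect_eq by (intro exI[of _ "\<lambda>k. l (Suc k)"]) simp
    moreover have "l 0 = 0 \<or> l 0 = m" using l(1) by blast
    ultimately show "x \<in> partial_spectrum m (Suc (Suc n))"
      unfolding l(2) partial_spectrum_Suc_iff[of _ m "Suc n"] by blast
  qed
qed

lemma Gamma_set_eq: "Gamma_set m = (\<Union>n. partial_spectrum m n)"
proof -
  have "Gamma_set m = (\<Union>n. partial_spectrum m (Suc n))"
    unfolding Gamma_set_def partial_spectrum_eq_sums by blast
  also have "\<dots> = (\<Union>n. partial_spectrum m n)"
  proof (intro equalityI UN_least)
    show "partial_spectrum m (Suc n) \<subseteq> (\<Union>n. partial_spectrum m n)" for n by (rule UN_upper) simp
    show "partial_spectrum m n \<subseteq> (\<Union>n. partial_spectrum m (Suc n))" for n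
      using partial_spectrum_mono[of n "Suc n" m] by (rule order_trans[OF _ UN_upper]) auto
  qed
  finally show ?thesis .
qed

text \<open>Equal lowest digits cancel and leave a factor 4; distinct ones differ by the odd number
  \<open>m\<close>, up to sign, so the difference is odd. The numbers of this form are zeros of
  \<open>mu_hat\<close>, whence orthogonality.\<close>

lemma partial_spectrum_diff:
  assumes "odd m" "a \<in> partial_spectrum m n" "b \<in> partial_spectrum m n" "a \<noteq> b"
  shows "\<exists>k i. odd i \<and> int a - int b = 4 ^ k * i"
  using assms(2-)
proof (induction n arbitrary: a b)
  case (Suc n)
  obtain a' e where a: "a' \<in> partial_spectrum m n" "e \<in> {0, m}" "a = 4 * a' + e"
    using Suc.prems(1) unfolding partial_spectrum_Suc_iff by blast
  obtain b' f where b: "b' \<in> partial_spectrum m n" "f \<in> {0, m}" "b = 4 * b' + f"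
    using Suc.prems(2) unfolding partial_spectrum_Suc_iff by blast
  show ?case
  proof (cases "e = f")
    case True
    then have "a' \<noteq> b'" using Suc.prems a b by auto
    then obtain k i where "odd i" "int a' - int b' = 4 ^ k * i" using Suc.IH a b by blast
    then show ?thesis using a b True by (intro exI[of _ "Suc k"] exI[of _ i]) auto
  next
    case False
    then have "odd (int a - int b)" using a b \<open>odd m\<close> by auto
    then show ?thesis by (intro exI[of _ 0] exI[of _ "int a - int b"]) simp
  qed
qed auto

section \<open>The Fourier transform of the invariant measure\<close>

locale self_similar_measure =
  fixes \<mu> :: "real measure"
  assumes invariant: "invariant_measure \<mu>"
begin

sublocale real_distribution \<mu>
  using invariant unfolding invariant_measure_def real_distribution_def real_distribution_axioms_def by blast

text \<open>The measure is the image of its product with a fair coin under the map that applies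
  \<open>tau0\<close> or \<open>tau2\<close> according to the coin. Fubini then splits the integral;
  the bound on \<open>f\<close> supplies integrability.\<close>

lemma integral_self_similar:
  fixes f :: "real \<Rightarrow> complex"
  assumes f [measurable]: "f \<in> borel_measurable borel" and bound: "\<And>x. norm (f x) \<le> C"
  shows "(LINT x|\<mu>. f x) = ((LINT x|\<mu>. f (tau0 x)) + (LINT x|\<mu>. f (tau2 x))) / 2"
proof -
  define B where "B = measure_pmf (pmf_of_set (UNIV :: bool set))"
  have setsB [measurable_cong]: "sets B = sets (count_space UNIV)" by (simp add: B_def)
  interpret B: prob_space B unfolding B_def by (rule measure_pmf.prob_space_axioms)
  interpret P: pair_prob_space B \<mu> ..
  define g where "g = (\<lambda>(b, x). if b then tau2 x else tau0 x)"
  have [measurable]: "tau0 \<in> borel_measurable borel" "tau2 \<in> borel_measurable borel"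
    unfolding tau0_def[abs_def] tau2_def[abs_def] by measurable
  have [measurable]: "g \<in> borel_measurable (B \<Otimes>\<^sub>M \<mu>)"
    unfolding g_def by measurable
  have "distr (B \<Otimes>\<^sub>M \<mu>) borel g = \<mu>"
  proof (rule measure_eqI)
    fix E assume "E \<in> sets (distr (B \<Otimes>\<^sub>M \<mu>) borel g)"
    then have E [measurable]: "E \<in> sets borel" by simp
    have mE: "g -` E \<inter> space (B \<Otimes>\<^sub>M \<mu>) \<in> sets (B \<Otimes>\<^sub>M \<mu>)" by measurable
    have v: "Pair b -` (g -` E \<inter> space (B \<Otimes>\<^sub>M \<mu>)) = (if b then tau2 -` E else tau0 -` E)" for b
      by (auto simp: g_def space_pair_measure B_def)
    have "emeasure (distr (B \<Otimes>\<^sub>M \<mu>) borel g) E = (\<integral>\<^sup>+b. emeasure \<mu> (if b then tau2 -` E else tau0 -` E) \<partial>B)"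
      using mE by (simp add: emeasure_distr emeasure_pair_measure_alt v del: vimage_Int)
    also have "\<dots> = (emeasure \<mu> (tau0 -` E) + emeasure \<mu> (tau2 -` E)) / 2"
      unfolding B_def by (subst nn_integral_pmf_of_set) (auto simp: UNIV_bool add.commute)
    also have "\<dots> = ennreal ((measure \<mu> (tau0 -` E) + measure \<mu> (tau2 -` E)) / 2)"
      by (simp add: emeasure_eq_measure divide_ennreal flip: ennreal_plus ennreal_numeral)
    also have "\<dots> = emeasure \<mu> E"
      using invariant E by (simp add: invariant_measure_def emeasure_eq_measure)
    finally show "emeasure (distr (B \<Otimes>\<^sub>M \<mu>) borel g) E = emeasure \<mu> E" .
  qed simp
  then have "(LINT x|\<mu>. f x) = (LINT x|distr (B \<Otimes>\<^sub>M \<mu>) borel g. f x)" by simp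
  also have "\<dots> = (LINT z|(B \<Otimes>\<^sub>M \<mu>). f (g z))" by (intro integral_distr) measurable
  also have "\<dots> = (LINT b|B. LINT x|\<mu>. f (g (b, x)))"
    by (rule P.integral_fst'[symmetric], rule P.integrable_const_bound[of _ C]) (auto simp: bound)
  also have "\<dots> = (LINT b|B. (if b then LINT x|\<mu>. f (tau2 x) else LINT x|\<mu>. f (tau0 x)))"
    by (intro Bochner_Integration.integral_cong) (auto simp: g_def)
  also have "\<dots> = ((LINT x|\<mu>. f (tau0 x)) + (LINT x|\<mu>. f (tau2 x))) / 2"
    unfolding B_def by (subst integral_measure_pmf[of UNIV]) (auto simp: UNIV_bool scaleR_conv_of_real field_simps)
  finally show ?thesis .
qed

definition mu_hat :: "real \<Rightarrow> complex" where
  "mu_hat t = (LINT x|\<mu>. cis (2 * pi * t * x))"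

lemma mu_hat_eq_char: "mu_hat t = char \<mu> (2 * pi * t)"
  by (simp add: mu_hat_def char_def cis_conv_exp mult_ac)

lemma mu_hat_zero: "mu_hat 0 = 1"
  by (simp add: mu_hat_eq_char char_zero)

lemma mu_hat_le_one: "norm (mu_hat t) \<le> 1"
  by (simp add: mu_hat_eq_char cmod_char_le_1)

lemma continuous_mu_hat: "continuous_on UNIV mu_hat"
proof -
  have "continuous_on UNIV (char \<mu>)" by (simp add: continuous_at_imp_continuous_on isCont_char)
  then show ?thesis
    unfolding mu_hat_eq_char[abs_def] by (rule continuous_on_compose2) (auto intro!: continuous_intros)
qed

lemma mu_hat_minus: "mu_hat (- t) = cnj (mu_hat t)"
proof -
  have "cnj (mu_hat t) = (LINT x|\<mu>. cnj (cis (2 * pi * t * x)))"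
    unfolding mu_hat_def by simp
  then show ?thesis by (simp add: mu_hat_def cis_cnj)
qed

text \<open>Since \<open>tau2 x\<close> is \<open>tau0 x + 1 / 2\<close>, the two halves of the
  integral differ by the phase \<open>cis (pi * t)\<close>.\<close>

lemma mu_hat_rec: "mu_hat t = (1 + cis (pi * t)) / 2 * mu_hat (t / 4)"
proof -
  have "mu_hat t = ((LINT x|\<mu>. cis (2 * pi * t * tau0 x)) + (LINT x|\<mu>. cis (2 * pi * t * tau2 x))) / 2"
    unfolding mu_hat_def
    by (rule integral_self_similar[of _ 1]) (auto intro!: borel_measurable_continuous_onI continuous_intros)
  also have "(\<lambda>x. cis (2 * pi * t * tau0 x)) = (\<lambda>x. cis (2 * pi * (t / 4) * x))"
    by (simp add: tau0_def field_simps)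
  also have "(\<lambda>x. cis (2 * pi * t * tau2 x)) = (\<lambda>x. cis (pi * t) * cis (2 * pi * (t / 4) * x))"
  proof -
    have "2 * pi * t * tau2 x = pi * t + 2 * pi * (t / 4) * x" for x
      by (simp add: tau2_def field_simps)
    then show ?thesis by (simp add: cis_mult)
  qed
  finally show ?thesis unfolding mu_hat_def[of "t / 4"] by (simp add: field_simps)
qed

lemma norm_mu_hat_rec: "(norm (mu_hat t))\<^sup>2 = (1 + cos (pi * t)) / 2 * (norm (mu_hat (t / 4)))\<^sup>2"
proof -
  have "(norm (1 + cis (pi * t)))\<^sup>2 = 2 + 2 * cos (pi * t)"
    using sin_cos_squared_add[of "pi * t"] unfolding cmod_power2 by (simp add: power2_sum)
  then have "(norm ((1 + cis (pi * t)) / 2))\<^sup>2 = (1 + cos (pi * t)) / 2"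
    by (simp add: norm_divide power_divide)
  moreover have "(norm (mu_hat t))\<^sup>2 = (norm ((1 + cis (pi * t)) / 2))\<^sup>2 * (norm (mu_hat (t / 4)))\<^sup>2"
    by (subst mu_hat_rec) (simp only: norm_mult power_mult_distrib)
  ultimately show ?thesis by simp
qed

text \<open>At an odd integer the factor \<open>1 + cis (pi * t)\<close> vanishes, and the
  refinement equation passes a zero from \<open>t / 4\<close> to \<open>t\<close>.\<close>

lemma mu_hat_eq_zero:
  assumes "odd i"
  shows "mu_hat (4 ^ k * real_of_int i) = 0"
proof (induction k)
  case 0
  have "cos (pi * real_of_int i) = -1"
    using assms by (auto elim!: oddE simp: cos_eq_minus1)
  then show ?case using norm_mu_hat_rec[of i] by simp
next
  case (Suc k)
  then show ?case by (subst mu_hat_rec) simp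
qed

section \<open>Sums of the squared transform over the spectrum\<close>

text \<open>The weight in \<open>norm_mu_hat_rec\<close> at \<open>t + 4 * x + e\<close> depends on
  the lowest digit \<open>e\<close> only: adding \<open>4 * x\<close> preserves the cosine, and
  adding the odd \<open>m\<close> changes its sign.\<close>

lemma sum_partial_spectrum:
  assumes "odd m"
  shows "(\<Sum>l\<in>partial_spectrum m n. (norm (mu_hat (t + real l)))\<^sup>2) =
    (transfer m ^^ n) (\<lambda>t. (norm (mu_hat t))\<^sup>2) t"
proof (induction n arbitrary: t)
  case (Suc n)
  let ?G = "partial_spectrum m n" and ?f = "\<lambda>t. (norm (mu_hat t))\<^sup>2"
  have disj: "(\<lambda>x. 4 * x) ` ?G \<inter> (\<lambda>x. 4 * x + m) ` ?G = {}"
    using assms by (auto, presburger)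
  have c: "cos (pi * (t + real (4 * x))) = cos (pi * t)" for x
  proof -
    have "cos (pi * (t + real (4 * x))) = cos (pi * t + real (4 * x) * pi)"
      by (simp add: algebra_simps)
    then show ?thesis unfolding cos_add cos_npi sin_npi by (simp add: power_mult)
  qed
  have cm: "cos (pi * (t + real (4 * x + m))) = - cos (pi * t)" for x
  proof -
    have "cos (pi * (t + real (4 * x + m))) = cos (pi * t + real (4 * x + m) * pi)"
      by (simp add: algebra_simps)
    then show ?thesis unfolding cos_add cos_npi sin_npi using assms by (simp add: power_mult power_add)
  qed
  have "(\<Sum>l\<in>partial_spectrum m (Suc n). ?f (t + real l)) =
      (\<Sum>x\<in>?G. ?f (t + real (4 * x))) + (\<Sum>x\<in>?G. ?f (t + real (4 * x + m)))"
    unfolding partial_spectrum.simps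
    by (subst sum.union_disjoint[OF _ _ disj]) (auto simp: sum.reindex inj_on_def)
  also have "\<dots> = (\<Sum>x\<in>?G. (1 + cos (pi * t)) / 2 * ?f (t / 4 + real x))
      + (\<Sum>x\<in>?G. (1 - cos (pi * t)) / 2 * ?f ((t + real m) / 4 + real x))"
    by (subst (1 2) norm_mu_hat_rec, unfold c cm) (simp add: field_simps)
  also have "\<dots> = transfer m ((transfer m ^^ n) ?f) t"
    unfolding sum_distrib_left[symmetric] Suc.IH by (simp add: transfer_def)
  finally show ?case by simp
qed simp

text \<open>The sums grow with \<open>j\<close>, and stay below 1 because the transfer operator
  preserves that bound. Their limit is therefore a fixed point of the operator.\<close>

lemma sum_partial_spectrum_tendsto_one:
  assumes m: "odd m"
    and no_cycle: "\<And>S. 0 \<notin> S \<Longrightarrow>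
      (\<And>x::int. x \<in> S \<Longrightarrow> \<exists>y\<in>S. 4 * y = x \<or> 4 * y = x + int m) \<Longrightarrow> S = {}"
  shows "(\<lambda>j. \<Sum>l\<in>partial_spectrum m j. (norm (mu_hat (t + real l)))\<^sup>2) \<longlonglongrightarrow> 1"
proof -
  define h where "h = (\<lambda>j. (transfer m ^^ j) (\<lambda>t. (norm (mu_hat t))\<^sup>2))"
  have h_Suc: "h (Suc j) = transfer m (h j)" for j by (simp add: h_def)
  have h_sum: "h j = (\<lambda>t. \<Sum>l\<in>partial_spectrum m j. (norm (mu_hat (t + real l)))\<^sup>2)" for j
    unfolding h_def using sum_partial_spectrum[OF m] by auto
  have le1: "h j t \<le> 1" for j t
  proof (induction j arbitrary: t)
    case 0
    then show ?case by (simp add: h_def power_le_one mu_hat_le_one)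
  next
    case (Suc j)
    then show ?case unfolding h_Suc by (rule transfer_le_one)
  qed
  have inc: "incseq (\<lambda>j. h j t)" for t
    unfolding h_sum by (intro incseq_SucI sum_mono2 partial_spectrum_mono) auto
  have cont: "continuous_on UNIV (h j)" for j
    unfolding h_sum
    by (intro continuous_intros continuous_on_compose2[OF continuous_mu_hat]) auto
  define H where "H = (\<lambda>t. lim (\<lambda>j. h j t))"
  have lim: "(\<lambda>j. h j t) \<longlonglongrightarrow> H t" for t
    using incseq_convergent[OF inc, of t 1] le1 unfolding H_def by (metis limI)
  have "H t = 1"
  proof (rule transfer_fixed_point_eq_one[of H m h])
    fix t
    have "(\<lambda>j. h (Suc j) t) \<longlonglongrightarrow> transfer m H t"
      unfolding h_Suc transfer_def by (intro tendsto_intros lim)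
    then show "H t = transfer m H t"
      using LIMSEQ_unique LIMSEQ_Suc[OF lim] by blast
    show "H t \<le> 1" by (rule LIMSEQ_le_const2[OF lim]) (simp add: le1)
    show "h j t \<le> H t" for j by (rule incseq_le[OF inc lim])
    show "h 0 0 = 1" by (simp add: h_def mu_hat_zero)
  qed (use cont lim no_cycle in auto)
  then show ?thesis using lim[of t] unfolding h_sum by simp
qed

section \<open>Bounded support of the measure\<close>

text \<open>For \<open>R >= 1\<close> both maps send \<open>{-2 * R..2 * R}\<close> into
  \<open>{-R..R}\<close>, so by invariance doubling the interval gains no mass. The doubled
  intervals exhaust the line.\<close>

lemma AE_in_unit_interval: "AE x in \<mu>. x \<in> {-1..1}"
proof -
  have step: "measure \<mu> {- (2 ^ Suc k)..2 ^ Suc k} \<le> measure \<mu> {- (2 ^ k)..2 ^ k}" for k :: nat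
  proof -
    let ?E = "{- (2 ^ k)..2 ^ k} :: real set" and ?E' = "{- (2 ^ Suc k)..2 ^ Suc k} :: real set"
    have k: "(2::real) ^ k \<ge> 1" by simp
    have b: "tau0 \<in> borel_measurable borel" "tau2 \<in> borel_measurable borel"
      unfolding tau0_def[abs_def] tau2_def[abs_def] by measurable
    have s: "tau0 -` ?E \<in> sets borel" "tau2 -` ?E \<in> sets borel"
      using measurable_sets[OF b(1), of ?E] measurable_sets[OF b(2), of ?E] by auto
    have "- (2 ^ k) \<le> tau0 x \<and> tau0 x \<le> 2 ^ k \<and> - (2 ^ k) \<le> tau2 x \<and> tau2 x \<le> 2 ^ k"
      if "- (2 * 2 ^ k) \<le> x" "x \<le> 2 * 2 ^ k" for x
      using that k unfolding tau0_def tau2_def by argo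
    then have "?E' \<subseteq> tau0 -` ?E" "?E' \<subseteq> tau2 -` ?E" by auto
    then have "measure \<mu> ?E' \<le> measure \<mu> (tau0 -` ?E)" "measure \<mu> ?E' \<le> measure \<mu> (tau2 -` ?E)"
      using s by (auto intro!: finite_measure_mono)
    moreover have "measure \<mu> ?E = (measure \<mu> (tau0 -` ?E) + measure \<mu> (tau2 -` ?E)) / 2"
      using invariant by (simp add: invariant_measure_def)
    ultimately show ?thesis by simp
  qed
  have le: "measure \<mu> {- (2 ^ k)..2 ^ k} \<le> measure \<mu> {-1..1}" for k :: nat
  proof (induction k)
    case (Suc k)
    then show ?case using step order_trans by blast
  qed simp
  have "(\<lambda>k. measure \<mu> {- (2 ^ k)..2 ^ k}) \<longlonglongrightarrow> measure \<mu> (\<Union>k. {- (2 ^ k)..2 ^ k})"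
    by (rule finite_Lim_measure_incseq) (auto simp: incseq_Suc_iff)
  also have "(\<Union>k. {- (2 ^ k)..2 ^ k}) = (UNIV :: real set)"
  proof -
    have "\<exists>k. x \<in> {- (2 ^ k)..2 ^ k}" for x :: real
    proof -
      obtain k where "\<bar>x\<bar> < 2 ^ k" using real_arch_pow[of 2 "\<bar>x\<bar>"] by auto
      then show ?thesis by (intro exI[of _ k]) auto
    qed
    then show ?thesis by blast
  qed
  finally have "(\<lambda>k. measure \<mu> {- (2 ^ k)..2 ^ k}) \<longlonglongrightarrow> 1"
    using prob_space by simp
  then have "1 \<le> measure \<mu> {-1..1}" using le by (intro LIMSEQ_le_const2) auto
  then have "prob {-1..1} = 1" using prob_le_1 by (intro antisym) auto
  then show ?thesis by (rule AE_prob_1)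
qed

end

section \<open>Closed spans of square-integrable families\<close>

text \<open>The crude bound \<open>2 * a\<^sup>2 + 2 * b\<^sup>2\<close> for
  \<open>(a + b)\<^sup>2\<close> takes the place of the triangle inequality for the norm in the
  closure arguments below.\<close>

lemma square_integrable_add:
  assumes f: "square_integrable M f" and g: "square_integrable M g"
  shows "square_integrable M (\<lambda>x. f x + g x)"
    and "(LINT x|M. (norm (f x + g x))\<^sup>2) \<le> 2 * (LINT x|M. (norm (f x))\<^sup>2) + 2 * (LINT x|M. (norm (g x))\<^sup>2)"
proof -
  have [measurable]: "f \<in> borel_measurable M" "g \<in> borel_measurable M"
    and i: "integrable M (\<lambda>x. (norm (f x))\<^sup>2)" "integrable M (\<lambda>x. (norm (g x))\<^sup>2)"
    using f g by (auto simp: square_integrable_def)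
  have le: "(norm (f x + g x))\<^sup>2 \<le> 2 * (norm (f x))\<^sup>2 + 2 * (norm (g x))\<^sup>2" for x
  proof -
    have "(norm (f x + g x))\<^sup>2 \<le> (norm (f x) + norm (g x))\<^sup>2"
      by (intro power_mono norm_triangle_ineq) auto
    also have "\<dots> \<le> 2 * (norm (f x))\<^sup>2 + 2 * (norm (g x))\<^sup>2"
      using sum_squares_bound[of "norm (f x)" "norm (g x)"] by (simp add: power2_sum)
    finally show ?thesis .
  qed
  have i2: "integrable M (\<lambda>x. 2 * (norm (f x))\<^sup>2 + 2 * (norm (g x))\<^sup>2)" using i by auto
  have i3: "integrable M (\<lambda>x. (norm (f x + g x))\<^sup>2)"
    by (rule Bochner_Integration.integrable_bound[OF i2]) (auto simp: le)
  then show "square_integrable M (\<lambda>x. f x + g x)" by (simp add: square_integrable_def)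
  have "(LINT x|M. (norm (f x + g x))\<^sup>2) \<le> (LINT x|M. 2 * (norm (f x))\<^sup>2 + 2 * (norm (g x))\<^sup>2)"
    by (rule integral_mono[OF i3 i2 le])
  then show "(LINT x|M. (norm (f x + g x))\<^sup>2) \<le> 2 * (LINT x|M. (norm (f x))\<^sup>2) + 2 * (LINT x|M. (norm (g x))\<^sup>2)"
    using i by simp
qed

lemma square_integrable_scale:
  "square_integrable M f \<Longrightarrow> square_integrable M (\<lambda>x. c * f x)"
  by (auto simp: square_integrable_def norm_mult power_mult_distrib)

lemma square_integrable_diff:
  "square_integrable M f \<Longrightarrow> square_integrable M g \<Longrightarrow> square_integrable M (\<lambda>x. f x - g x)"
  using square_integrable_add(1)[of M f "\<lambda>x. -1 * g x"] square_integrable_scale[of M g "-1"] by simp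

lemma square_integrable_sum:
  "(\<And>i. i \<in> F \<Longrightarrow> square_integrable M (f i)) \<Longrightarrow> square_integrable M (\<lambda>x. \<Sum>i\<in>F. f i x)"
proof (induction F rule: infinite_finite_induct)
  case (insert i F)
  then show ?case by (simp add: square_integrable_add(1))
qed (auto simp: square_integrable_def)

lemma (in finite_measure) square_integrable_bounded:
  assumes "f \<in> borel_measurable M" "\<And>x. norm (f x) \<le> C"
  shows "square_integrable M f"
  unfolding square_integrable_def
proof
  show "integrable M (\<lambda>x. (norm (f x))\<^sup>2)"
    by (rule integrable_const_bound[of _ "C\<^sup>2"]) (use assms in \<open>auto intro!: power_mono\<close>)
qed fact

text \<open>The error is the squared distance, so that no square roots appear before the final
  comparison with \<open>L2_norm\<close>.\<close>

definition in_closed_span :: "'a measure \<Rightarrow> 'i set \<Rightarrow> ('i \<Rightarrow> 'a \<Rightarrow> complex) \<Rightarrow> ('a \<Rightarrow> complex) \<Rightarrow> bool" where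
  "in_closed_span M I e f \<longleftrightarrow> square_integrable M f \<and>
     (\<forall>\<epsilon>>0. \<exists>F c. finite F \<and> F \<subseteq> I \<and> (LINT x|M. (norm (f x - (\<Sum>i\<in>F. c i * e i x)))\<^sup>2) < \<epsilon>)"

locale square_integrable_family =
  fixes M :: "'a measure" and I :: "'i set" and e :: "'i \<Rightarrow> 'a \<Rightarrow> complex"
  assumes square_integrable_family: "i \<in> I \<Longrightarrow> square_integrable M (e i)"
begin

abbreviation "closed_span \<equiv> in_closed_span M I e"

lemma square_integrable_comb:
  "F \<subseteq> I \<Longrightarrow> square_integrable M (\<lambda>x. \<Sum>i\<in>F. c i * e i x)"
  using square_integrable_family by (auto intro!: square_integrable_sum square_integrable_scale)

lemma closed_span_add:
  assumes f: "closed_span f" and g: "closed_span g"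
  shows "closed_span (\<lambda>x. f x + g x)"
  unfolding in_closed_span_def
proof (intro conjI allI impI)
  have sq: "square_integrable M f" "square_integrable M g" using f g by (auto simp: in_closed_span_def)
  then show "square_integrable M (\<lambda>x. f x + g x)" by (rule square_integrable_add)
  fix \<epsilon> :: real assume "\<epsilon> > 0"
  \<comment> \<open>Each of the two errors is doubled by
    \<open>square_integrable_add\<close>.\<close>
  then have "\<epsilon> / 4 > 0" by simp
  then obtain F c G d
    where F: "finite F" "F \<subseteq> I" "(LINT x|M. (norm (f x - (\<Sum>i\<in>F. c i * e i x)))\<^sup>2) < \<epsilon> / 4"
      and G: "finite G" "G \<subseteq> I" "(LINT x|M. (norm (g x - (\<Sum>i\<in>G. d i * e i x)))\<^sup>2) < \<epsilon> / 4"
    using f g unfolding in_closed_span_def by meson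
  \<comment> \<open>Extension by 0 puts both combinations over the common index set
    \<open>F \<union> G\<close>.\<close>
  define b where "b = (\<lambda>i. (if i \<in> F then c i else 0) + (if i \<in> G then d i else 0))"
  have "(\<Sum>i\<in>F \<union> G. b i * e i x) = (\<Sum>i\<in>F. c i * e i x) + (\<Sum>i\<in>G. d i * e i x)" for x
  proof -
    have "(\<Sum>i\<in>F \<union> G. (if i \<in> F then c i else 0) * e i x) = (\<Sum>i\<in>F. c i * e i x)"
      "(\<Sum>i\<in>F \<union> G. (if i \<in> G then d i else 0) * e i x) = (\<Sum>i\<in>G. d i * e i x)"
      using F G by (auto intro!: sum.mono_neutral_cong_right)
    then show ?thesis by (simp add: b_def distrib_right sum.distrib)
  qed
  then have eq: "f x + g x - (\<Sum>i\<in>F \<union> G. b i * e i x) =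
      (f x - (\<Sum>i\<in>F. c i * e i x)) + (g x - (\<Sum>i\<in>G. d i * e i x))" for x by simp
  have "(LINT x|M. (norm (f x + g x - (\<Sum>i\<in>F \<union> G. b i * e i x)))\<^sup>2) < \<epsilon>"
    unfolding eq
    using square_integrable_add(2)[OF square_integrable_diff[OF sq(1) square_integrable_comb[OF F(2), of c]]
        square_integrable_diff[OF sq(2) square_integrable_comb[OF G(2), of d]]] F(3) G(3)
    by linarith
  then show "\<exists>F c. finite F \<and> F \<subseteq> I \<and> (LINT x|M. (norm (f x + g x - (\<Sum>i\<in>F. c i * e i x)))\<^sup>2) < \<epsilon>"
    using F G by (intro exI[of _ "F \<union> G"] exI[of _ b]) auto
qed

lemma closed_span_scale:
  assumes f: "closed_span f"
  shows "closed_span (\<lambda>x. a * f x)"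
  unfolding in_closed_span_def
proof (intro conjI allI impI)
  have sq: "square_integrable M f" using f by (auto simp: in_closed_span_def)
  then show "square_integrable M (\<lambda>x. a * f x)" by (rule square_integrable_scale)
  fix \<epsilon> :: real assume "\<epsilon> > 0"
  \<comment> \<open>The summand 1 keeps the divisor positive when \<open>a = 0\<close>.\<close>
  define C where "C = (norm a)\<^sup>2 + 1"
  have C: "C > 0" by (simp add: C_def add_nonneg_pos)
  obtain F c where F: "finite F" "F \<subseteq> I" "(LINT x|M. (norm (f x - (\<Sum>i\<in>F. c i * e i x)))\<^sup>2) < \<epsilon> / C"
    using f \<open>\<epsilon> > 0\<close> C unfolding in_closed_span_def by (meson divide_pos_pos)
  have eq: "a * f x - (\<Sum>i\<in>F. a * c i * e i x) = a * (f x - (\<Sum>i\<in>F. c i * e i x))" for x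
    by (simp add: algebra_simps sum_distrib_left)
  have "(LINT x|M. (norm (a * f x - (\<Sum>i\<in>F. a * c i * e i x)))\<^sup>2) =
      (norm a)\<^sup>2 * (LINT x|M. (norm (f x - (\<Sum>i\<in>F. c i * e i x)))\<^sup>2)"
    unfolding eq by (simp add: norm_mult power_mult_distrib)
  also have "\<dots> \<le> C * (LINT x|M. (norm (f x - (\<Sum>i\<in>F. c i * e i x)))\<^sup>2)"
    by (intro mult_right_mono) (auto simp: C_def)
  also have "\<dots> < \<epsilon>" using F(3) C by (simp add: field_simps)
  finally show "\<exists>F c. finite F \<and> F \<subseteq> I \<and> (LINT x|M. (norm (a * f x - (\<Sum>i\<in>F. c i * e i x)))\<^sup>2) < \<epsilon>"
    using F by (intro exI[of _ F] exI[of _ "\<lambda>i. a * c i"]) auto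
qed

lemma closed_span_zero: "closed_span (\<lambda>x. 0)"
  by (auto simp: in_closed_span_def square_integrable_def intro!: exI[of _ "{}"])

lemma closed_span_sum:
  "(\<And>i. i \<in> F \<Longrightarrow> closed_span (f i)) \<Longrightarrow> closed_span (\<lambda>x. \<Sum>i\<in>F. f i x)"
  by (induction F rule: infinite_finite_induct) (auto intro: closed_span_zero closed_span_add)

lemma closed_span_closed:
  assumes f: "square_integrable M f"
    and lim: "\<And>\<epsilon>. \<epsilon> > 0 \<Longrightarrow> \<exists>g. closed_span g \<and> (LINT x|M. (norm (f x - g x))\<^sup>2) < \<epsilon>"
  shows "closed_span f"
  unfolding in_closed_span_def
proof (intro conjI allI impI f)
  fix \<epsilon> :: real assume "\<epsilon> > 0"
  then have pos: "\<epsilon> / 4 > 0" by simp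
  obtain g where g: "closed_span g" "(LINT x|M. (norm (f x - g x))\<^sup>2) < \<epsilon> / 4" using lim[OF pos] by blast
  then obtain F c where F: "finite F" "F \<subseteq> I" "(LINT x|M. (norm (g x - (\<Sum>i\<in>F. c i * e i x)))\<^sup>2) < \<epsilon> / 4"
    using pos unfolding in_closed_span_def by meson
  have sq: "square_integrable M g" using g by (simp add: in_closed_span_def)
  have eq: "f x - (\<Sum>i\<in>F. c i * e i x) = (f x - g x) + (g x - (\<Sum>i\<in>F. c i * e i x))" for x by simp
  have "(LINT x|M. (norm (f x - (\<Sum>i\<in>F. c i * e i x)))\<^sup>2) < \<epsilon>"
    unfolding eq
    using square_integrable_add(2)[OF square_integrable_diff[OF f sq]
        square_integrable_diff[OF sq square_integrable_comb[OF F(2), of c]]] F(3) g(2)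
    by linarith
  then show "\<exists>F c. finite F \<and> F \<subseteq> I \<and> (LINT x|M. (norm (f x - (\<Sum>i\<in>F. c i * e i x)))\<^sup>2) < \<epsilon>"
    using F by blast
qed

text \<open>The squared errors tend to 0 pointwise and are dominated by
  \<open>4 * (w x)\<^sup>2\<close>, so their integrals tend to 0 and closedness applies.\<close>

lemma closed_span_dominated_limit:
  assumes s: "\<And>n. closed_span (s n)"
    and lim: "\<And>x. x \<in> space M \<Longrightarrow> (\<lambda>n. s n x) \<longlonglongrightarrow> f x"
    and bound: "\<And>n x. x \<in> space M \<Longrightarrow> norm (s n x) \<le> w x"
    and w: "integrable M (\<lambda>x. (w x)\<^sup>2)"
  shows "closed_span f"
proof (rule closed_span_closed)
  have [measurable]: "s n \<in> borel_measurable M" for n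
    using s[of n] by (simp add: in_closed_span_def square_integrable_def)
  have f [measurable]: "f \<in> borel_measurable M"
    by (rule borel_measurable_LIMSEQ_metric[OF _ lim]) auto
  have bf: "norm (f x) \<le> w x" if "x \<in> space M" for x
    by (rule LIMSEQ_le_const2[OF tendsto_norm[OF lim[OF that]]]) (use bound that in auto)
  have "integrable M (\<lambda>x. (norm (f x))\<^sup>2)"
    by (rule Bochner_Integration.integrable_bound[OF w]) (auto intro!: AE_I2 power_mono bf)
  then show "square_integrable M f" by (simp add: square_integrable_def f)
  have le: "(norm (f x - s n x))\<^sup>2 \<le> 4 * (w x)\<^sup>2" if "x \<in> space M" for x n
  proof -
    have "norm (f x - s n x) \<le> 2 * w x"
      using norm_triangle_ineq4[of "f x" "s n x"] bf[OF that] bound[OF that, of n] by linarith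
    then have "(norm (f x - s n x))\<^sup>2 \<le> (2 * w x)\<^sup>2" by (intro power_mono) auto
    then show ?thesis by (simp add: power_mult_distrib)
  qed
  have "(\<lambda>n. LINT x|M. (norm (f x - s n x))\<^sup>2) \<longlonglongrightarrow> (LINT x|M. 0)"
  proof (rule integral_dominated_convergence)
    show "integrable M (\<lambda>x. 4 * (w x)\<^sup>2)" using w by simp
    show "AE x in M. (\<lambda>n. (norm (f x - s n x))\<^sup>2) \<longlonglongrightarrow> 0"
    proof (rule AE_I2)
      fix x assume "x \<in> space M"
      then have "(\<lambda>n. (norm (f x - s n x))\<^sup>2) \<longlonglongrightarrow> (norm (f x - f x))\<^sup>2"
        by (intro tendsto_intros lim)
      then show "(\<lambda>n. (norm (f x - s n x))\<^sup>2) \<longlonglongrightarrow> 0" by simp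
    qed
  qed (auto simp: le)
  then show "\<exists>g. closed_span g \<and> (LINT x|M. (norm (f x - g x))\<^sup>2) < \<epsilon>" if "\<epsilon> > 0" for \<epsilon>
  proof -
    have "eventually (\<lambda>n. (LINT x|M. (norm (f x - s n x))\<^sup>2) < \<epsilon>) sequentially"
      using \<open>(\<lambda>n. LINT x|M. (norm (f x - s n x))\<^sup>2) \<longlonglongrightarrow> (LINT x|M. 0)\<close> that
      by (intro order_tendstoD(2)[of _ 0]) simp_all
    then show ?thesis using s by (auto simp: eventually_sequentially)
  qed
qed

end

text \<open>Simple functions converge to \<open>f\<close> pointwise within the bound
  \<open>2 * norm (f x)\<close>, which is square-integrable; each is a finite combination of
  indicators.\<close>

lemma (in prob_space) closed_span_total:
  assumes "square_integrable_family M I e"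
    and ind: "\<And>A. A \<in> sets M \<Longrightarrow> in_closed_span M I e (indicator A)"
    and f: "square_integrable M f"
  shows "in_closed_span M I e f"
proof -
  interpret square_integrable_family M I e by fact
  have "f \<in> borel_measurable M" using f by (simp add: square_integrable_def)
  from borel_measurable_implies_sequence_metric[OF this, of 0] obtain s where
    s0: "(\<forall>i. simple_function M (s i)) \<and> (\<forall>x\<in>space M. (\<lambda>i. s i x) \<longlonglongrightarrow> f x) \<and>
      (\<forall>i. \<forall>x\<in>space M. dist (s i x) 0 \<le> 2 * dist (f x) 0)"
    by (rule exE)
  then have s: "\<And>i. simple_function M (s i)" "\<And>x. x \<in> space M \<Longrightarrow> (\<lambda>i. s i x) \<longlonglongrightarrow> f x"
       "\<And>i x. x \<in> space M \<Longrightarrow> norm (s i x) \<le> 2 * norm (f x)"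
    by simp_all
  \<comment> \<open>The representation by indicators agrees with \<open>s\<close> only on
    \<open>space M\<close>, so it gets its own name.\<close>
  define s' where "s' = (\<lambda>i x. \<Sum>y\<in>s i ` space M. y * indicator (s i -` {y} \<inter> space M) x)"
  have s': "s i x = s' i x" if "x \<in> space M" for i x
    unfolding s'_def
    by (rule trans[OF simple_function_indicator_representation_banach[OF s(1) that]])
      (auto intro!: sum.cong simp: indicator_def)
  show ?thesis
  proof (rule closed_span_dominated_limit[of s'])
    show "in_closed_span M I e (s' i)" for i
      unfolding s'_def using simple_functionD(2)[OF s(1)]
      by (intro closed_span_sum closed_span_scale ind) auto
    show "integrable M (\<lambda>x. (2 * norm (f x))\<^sup>2)"
      using f by (simp add: square_integrable_def power_mult_distrib)
  qed (use s s' in auto)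
qed

section \<open>Trigonometric polynomials on a bounded interval\<close>

abbreviation wave :: "real \<Rightarrow> real \<Rightarrow> complex" where
  "wave t x \<equiv> cis (2 * pi * t * x)"

inductive trig_poly :: "(real \<Rightarrow> complex) \<Rightarrow> bool" where
  trig_poly_wave: "trig_poly (\<lambda>x. c * wave t x)"
| trig_poly_add: "trig_poly f \<Longrightarrow> trig_poly g \<Longrightarrow> trig_poly (\<lambda>x. f x + g x)"

lemma trig_poly_mult:
  assumes "trig_poly f" "trig_poly g"
  shows "trig_poly (\<lambda>x. f x * g x)"
  using assms
proof (induction f)
  case (trig_poly_wave c t)
  then show ?case
  proof (induction g)
    case (trig_poly_wave d s)
    have w: "wave (t + s) x = wave t x * wave s x" for x
      by (simp add: cis_mult distrib_left distrib_right)
    have "(\<lambda>x. c * wave t x * (d * wave s x)) = (\<lambda>x. (c * d) * wave (t + s) x)"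
      unfolding w by (simp only: mult_ac)
    then show ?case using trig_poly.trig_poly_wave[of "c * d" "t + s"] by simp
  next
    case (trig_poly_add f g)
    then show ?case using trig_poly.trig_poly_add by (simp add: distrib_left)
  qed
next
  case (trig_poly_add f h)
  then show ?case using trig_poly.trig_poly_add by (simp add: distrib_right)
qed

lemma trig_poly_continuous: "trig_poly f \<Longrightarrow> continuous_on S f"
  by (induction rule: trig_poly.induct) (auto intro!: continuous_intros)

lemma trig_poly_dense:
  fixes f :: "real \<Rightarrow> real"
  assumes f: "continuous_on {-1..1} f" and e: "e > 0"
  shows "\<exists>g. trig_poly (\<lambda>x. of_real (g x)) \<and> (\<forall>x\<in>{-1..1}. \<bar>f x - g x\<bar> < e)"
proof (rule Stone_Weierstrass_HOL[of "{-1..1}" "\<lambda>g. trig_poly (\<lambda>x. of_real (g x))"])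
  show "trig_poly (\<lambda>x. of_real c)" for c
    using trig_poly_wave[of "of_real c" 0] by simp
  show "continuous_on {-1..1} g" if "trig_poly (\<lambda>x. of_real (g x))" for g
    using continuous_on_Re[OF trig_poly_continuous[OF that]] by simp
  show "trig_poly (\<lambda>x. of_real (g x + h x))"
    if "trig_poly (\<lambda>x. of_real (g x)) \<and> trig_poly (\<lambda>x. of_real (h x))" for g h
    using that trig_poly_add by simp
  show "trig_poly (\<lambda>x. of_real (g x * h x))"
    if "trig_poly (\<lambda>x. of_real (g x)) \<and> trig_poly (\<lambda>x. of_real (h x))" for g h
    using that trig_poly_mult by simp
  show "\<exists>g. trig_poly (\<lambda>x. of_real (g x)) \<and> g x \<noteq> g y"
    if xy: "x \<in> {-1..1} \<and> y \<in> {-1..1} \<and> x \<noteq> y" for x y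
  proof (intro exI conjI)
    \<comment> \<open>Euler's formula with frequencies \<open>1 / 8\<close> and
      \<open>- 1 / 8\<close>. This sine has its argument within \<open>pi / 2\<close> of 0 on
      \<open>{-1..1}\<close>, so it is injective there.\<close>
    have eq: "(\<lambda>x. complex_of_real (sin (pi / 4 * x))) =
        (\<lambda>x. - \<i> / 2 * wave (1 / 8) x + \<i> / 2 * wave (- 1 / 8) x)"
      by (rule ext) (simp add: complex_eq_iff)
    show "trig_poly (\<lambda>x. of_real (sin (pi / 4 * x)))"
      unfolding eq
      using trig_poly_add[OF trig_poly_wave[of "- \<i> / 2" "1 / 8"] trig_poly_wave[of "\<i> / 2" "- 1 / 8"]] .
    have b: "- (pi / 2) \<le> pi / 4 * z \<and> pi / 4 * z \<le> pi / 2" if "z \<in> {-1..1}" for z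
    proof -
      have "pi * z \<le> pi * 2" "pi * (-2) \<le> pi * z" using that by (intro mult_left_mono; simp)+
      then show ?thesis by simp
    qed
    show "sin (pi / 4 * x) \<noteq> sin (pi / 4 * y)"
    proof
      assume "sin (pi / 4 * x) = sin (pi / 4 * y)"
      then have "pi / 4 * x = pi / 4 * y"
        using sin_inj_pi[of "pi / 4 * x" "pi / 4 * y"] b[of x] b[of y] xy by blast
      then show False using xy by simp
    qed
  qed
qed (use f e in auto)

section \<open>Totality of the exponentials\<close>

context self_similar_measure
begin

lemma wave_measurable [measurable]: "wave t \<in> borel_measurable borel"
  by (intro borel_measurable_continuous_onI continuous_intros)

lemma square_integrable_wave: "square_integrable \<mu> (wave t)"
  by (rule square_integrable_bounded[of _ 1]) auto

lemma integrable_wave: "integrable \<mu> (\<lambda>x. wave t x)"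
  by (rule integrable_const_bound[of _ 1]) auto

lemma wave_mult_cnj: "wave s x * cnj (wave t x) = wave (s - t) x"
  by (simp add: cis_cnj cis_mult algebra_simps)

lemma integral_wave_mult_cnj: "(LINT x|\<mu>. wave s x * cnj (wave t x)) = mu_hat (s - t)"
  by (simp add: wave_mult_cnj mu_hat_def)

section \<open>Orthonormality and the distance to a finite span\<close>

lemma mu_hat_diff_Gamma_set:
  assumes "odd m" "a \<in> Gamma_set m" "b \<in> Gamma_set m"
  shows "mu_hat (real a - real b) = (if a = b then 1 else 0)"
proof (cases "a = b")
  case False
  obtain i j where "a \<in> partial_spectrum m i" "b \<in> partial_spectrum m j"
    using assms unfolding Gamma_set_eq by blast
  then have "a \<in> partial_spectrum m (max i j)" "b \<in> partial_spectrum m (max i j)"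
    using partial_spectrum_mono[of i "max i j" m] partial_spectrum_mono[of j "max i j" m] by auto
  from partial_spectrum_diff[OF \<open>odd m\<close> this False]
  obtain k l where l: "odd l" "int a - int b = 4 ^ k * l" by blast
  have "real a - real b = real_of_int (int a - int b)" by simp
  also have "\<dots> = 4 ^ k * real_of_int l" unfolding l by simp
  finally show ?thesis using mu_hat_eq_zero[OF l(1)] False by simp
qed (simp add: mu_hat_zero)

text \<open>The coefficients are the Fourier coefficients of \<open>wave t\<close>. Expanding the
  square gives two cross terms and a double sum, which orthonormality reduces to its
  diagonal.\<close>

lemma wave_distance:
  assumes "odd m" and F: "F \<subseteq> Gamma_set m"
  shows "(LINT x|\<mu>. (norm (wave t x - (\<Sum>i\<in>F. mu_hat (t - real i) * wave (real i) x)))\<^sup>2) =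
    1 - (\<Sum>i\<in>F. (norm (mu_hat (t - real i)))\<^sup>2)"
proof -
  let ?c = "\<lambda>i. mu_hat (t - real i)"
  let ?s = "\<lambda>x. \<Sum>i\<in>F. ?c i * wave (real i) x"
  have fin: "?c i * cnj (?c j) * mu_hat (real i - real j) = (if i = j then ?c i * cnj (?c i) else 0)"
    if "i \<in> F" "j \<in> F" for i j
    using mu_hat_diff_Gamma_set[OF assms(1), of i j] that F by (auto simp: subset_iff)
  have eq: "of_real ((norm (wave t x - ?s x))\<^sup>2) =
      1 - (\<Sum>i\<in>F. cnj (?c i) * wave (t - real i) x) - (\<Sum>i\<in>F. ?c i * wave (real i - t) x)
      + (\<Sum>i\<in>F. \<Sum>j\<in>F. ?c i * cnj (?c j) * wave (real i - real j) x)" for x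
  proof -
    have "of_real ((norm (wave t x - ?s x))\<^sup>2) = (wave t x - ?s x) * cnj (wave t x - ?s x)"
      by (rule complex_norm_square)
    also have "\<dots> = wave t x * cnj (wave t x) - wave t x * cnj (?s x) - ?s x * cnj (wave t x) + ?s x * cnj (?s x)"
      by (simp add: algebra_simps)
    also have "wave t x * cnj (wave t x) = 1" by (simp add: wave_mult_cnj)
    also have "wave t x * cnj (?s x) = (\<Sum>i\<in>F. cnj (?c i) * wave (t - real i) x)"
      unfolding wave_mult_cnj[symmetric] cnj_sum sum_distrib_left by (simp add: mult_ac)
    also have "?s x * cnj (wave t x) = (\<Sum>i\<in>F. ?c i * wave (real i - t) x)"
      unfolding wave_mult_cnj[symmetric] sum_distrib_right by (simp add: mult_ac)
    also have "?s x * cnj (?s x) = (\<Sum>i\<in>F. \<Sum>j\<in>F. ?c i * cnj (?c j) * wave (real i - real j) x)"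
      unfolding wave_mult_cnj[symmetric] cnj_sum sum_product by (simp add: mult_ac)
    finally show ?thesis .
  qed
  have "of_real (LINT x|\<mu>. (norm (wave t x - ?s x))\<^sup>2) =
      (LINT x|\<mu>. of_real ((norm (wave t x - ?s x))\<^sup>2) :: complex)"
    by (rule integral_complex_of_real[symmetric])
  also have "\<dots> = 1 - (\<Sum>i\<in>F. cnj (?c i) * mu_hat (t - real i)) - (\<Sum>i\<in>F. ?c i * mu_hat (real i - t))
      + (\<Sum>i\<in>F. \<Sum>j\<in>F. ?c i * cnj (?c j) * mu_hat (real i - real j))"
    unfolding eq using prob_space
    by (simp add: integrable_wave Bochner_Integration.integral_add Bochner_Integration.integral_diff
        Bochner_Integration.integral_sum flip: mu_hat_def)
  also have "(\<Sum>i\<in>F. ?c i * mu_hat (real i - t)) = (\<Sum>i\<in>F. ?c i * cnj (?c i))"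
    unfolding mu_hat_minus[symmetric] by simp
  also have "(\<Sum>i\<in>F. \<Sum>j\<in>F. ?c i * cnj (?c j) * mu_hat (real i - real j)) = (\<Sum>i\<in>F. ?c i * cnj (?c i))"
  \<comment> \<open>For infinite \<open>F\<close> both sides are 0 by the convention for
    sums.\<close>
  proof (cases "finite F")
    case True
    then show ?thesis by (simp add: fin sum.delta cong: sum.cong)
  qed simp
  also have "1 - (\<Sum>i\<in>F. cnj (?c i) * ?c i) - (\<Sum>i\<in>F. ?c i * cnj (?c i)) + (\<Sum>i\<in>F. ?c i * cnj (?c i)) =
      of_real (1 - (\<Sum>i\<in>F. (norm (?c i))\<^sup>2))"
    by (simp add: complex_norm_square[symmetric] mult.commute[of "cnj _"])
  finally show ?thesis unfolding of_real_eq_iff .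
qed

section \<open>From exponentials to all square-integrable functions\<close>

text \<open>Uniform approximation on \<open>{-1..1}\<close> is enough, since almost every point lies
  there; outside it the trigonometric polynomial is arbitrary.\<close>

lemma continuous_in_closed_span:
  assumes fam: "square_integrable_family \<mu> I e"
    and wave: "\<And>t. in_closed_span \<mu> I e (wave t)"
    and f: "continuous_on UNIV f" "\<And>x. \<bar>f x\<bar> \<le> C"
  shows "in_closed_span \<mu> I e (\<lambda>x. of_real (f x))"
proof -
  interpret square_integrable_family \<mu> I e by fact
  have trig: "in_closed_span \<mu> I e g" if "trig_poly g" for g
    using that by induction (auto intro: closed_span_scale closed_span_add wave)
  have [measurable]: "f \<in> borel_measurable borel" using f(1) by (rule borel_measurable_continuous_onI)
  have sf: "square_integrable \<mu> (\<lambda>x. of_real (f x))"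
    by (rule square_integrable_bounded[of _ C]) (auto simp: f)
  show ?thesis
  proof (rule closed_span_closed[OF sf])
    fix \<epsilon> :: real assume "\<epsilon> > 0"
    then have "sqrt (\<epsilon> / 2) > 0" by simp
    then obtain g where g: "trig_poly (\<lambda>x. of_real (g x))" "\<And>x. x \<in> {-1..1} \<Longrightarrow> \<bar>f x - g x\<bar> < sqrt (\<epsilon> / 2)"
      using trig_poly_dense[OF continuous_on_subset[OF f(1)]] by (metis subset_UNIV)
    let ?d = "\<lambda>x. (norm (complex_of_real (f x) - complex_of_real (g x)))\<^sup>2"
    have "integrable \<mu> ?d"
      using square_integrable_diff[OF sf, of "\<lambda>x. of_real (g x)"] trig[OF g(1)]
      by (simp add: square_integrable_def in_closed_span_def)
    moreover have "AE x in \<mu>. ?d x \<le> \<epsilon> / 2"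
      using AE_in_unit_interval
    proof eventually_elim
      fix x :: real assume "x \<in> {-1..1}"
      then have "\<bar>f x - g x\<bar>\<^sup>2 \<le> (sqrt (\<epsilon> / 2))\<^sup>2" by (intro power_mono less_imp_le[OF g(2)]) auto
      then show "?d x \<le> \<epsilon> / 2" using \<open>\<epsilon> > 0\<close> by (simp flip: of_real_diff)
    qed
    ultimately have "(LINT x|\<mu>. ?d x) \<le> (LINT x|\<mu>. \<epsilon> / 2)" by (intro integral_mono_AE) auto
    also have "\<dots> < \<epsilon>" using \<open>\<epsilon> > 0\<close> prob_space by simp
    finally show "\<exists>h. in_closed_span \<mu> I e h \<and> (LINT x|\<mu>. (norm (of_real (f x) - h x))\<^sup>2) < \<epsilon>"
      using trig[OF g(1)] by blast
  qed
qed

text \<open>A Dynkin argument: closed half-lines are stable under intersection and generate the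
  Borel sets, and the sets with indicator in the closed span admit complements and countable
  disjoint unions.\<close>

lemma indicator_in_closed_span:
  assumes fam: "square_integrable_family \<mu> I e"
    and wave: "\<And>t. in_closed_span \<mu> I e (wave t)"
    and A: "A \<in> sets \<mu>"
  shows "in_closed_span \<mu> I e (indicator A)"
proof -
  interpret square_integrable_family \<mu> I e by fact
  have atMost: "in_closed_span \<mu> I e (indicator {..a})" for a :: real
  proof (rule closed_span_dominated_limit)
    \<comment> \<open>For \<open>n > 0\<close> a continuous ramp that is 1 up to \<open>a\<close>
      and 0 from \<open>a + 1 / n\<close> on.\<close>
    define f where "f = (\<lambda>n x. max 0 (min 1 (1 - real n * (x - a))))"
    show "in_closed_span \<mu> I e (\<lambda>x. of_real (f n x))" for n
      by (rule continuous_in_closed_span[OF fam wave, of _ 1]) (auto simp: f_def intro!: continuous_intros)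
    show "norm (complex_of_real (f n x)) \<le> 1" for n x by (simp add: f_def)
    show "(\<lambda>n. complex_of_real (f n x)) \<longlonglongrightarrow> indicator {..a} x" for x
    proof (cases "x \<le> a")
      case True
      then have "real n * (x - a) \<le> 0" for n by (simp add: mult_nonneg_nonpos)
      then have "f n x = 1" for n unfolding f_def by (simp add: min_def)
      then show ?thesis using True by simp
    next
      case False
      obtain N where N: "1 < real N * (x - a)" using reals_Archimedean3[of "x - a"] False by auto
      have "f n x = 0" if "n \<ge> N" for n
      proof -
        have "real N * (x - a) \<le> real n * (x - a)" using that False by (intro mult_right_mono) auto
        then show ?thesis using N by (simp add: f_def)
      qed
      then have "eventually (\<lambda>n. complex_of_real (f n x) = 0) sequentially"
        by (auto simp: eventually_sequentially)
      then show ?thesis using False by (simp add: tendsto_eventually)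
    qed
  qed simp
  have one: "in_closed_span \<mu> I e (\<lambda>_. 1)" using wave[of 0] by simp
  have "Int_stable (range (\<lambda>a::real. {..a}))"
    by (auto simp: Int_stable_def)
  moreover have "range (\<lambda>a::real. {..a}) \<subseteq> Pow UNIV" by simp
  moreover have "A \<in> sigma_sets UNIV (range (\<lambda>a::real. {..a}))"
    using A by (simp add: borel_eq_atMost)
  ultimately show ?thesis
  proof (induction rule: sigma_sets_induct_disjoint)
    case (basic A)
    then show ?case using atMost by auto
  next
    case empty
    then show ?case using closed_span_zero by simp
  next
    case (compl A)
    have "(\<lambda>x. 1 + -1 * indicator A x :: complex) = indicator (UNIV - A)"
      by (auto simp: indicator_def fun_eq_iff)
    then show ?case using closed_span_add[OF one closed_span_scale[OF compl(2), of "-1"]] by simp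
  next
    case (union A)
    have "in_closed_span \<mu> I e (indicator (\<Union>i<n. A i))" for n
    proof -
      have "indicator (\<Union>i<n. A i) = (\<lambda>x. \<Sum>i<n. indicator (A i) x :: complex)"
        using union(1) by (intro ext indicator_UN_disjoint) (auto intro: disjoint_family_on_mono)
      then show ?thesis using closed_span_sum[of "{..<n}" "\<lambda>i. indicator (A i)"] union by simp
    qed
    then show ?case
    proof (rule closed_span_dominated_limit)
      show "(\<lambda>n. indicator (\<Union>i<n. A i) x :: complex) \<longlonglongrightarrow> indicator (\<Union>i. A i) x" for x
        by (rule LIMSEQ_indicator_UN)
      show "norm (indicator (\<Union>i<n. A i) x :: complex) \<le> 1" for n x by (simp add: indicator_def)
    qed simp
  qed
qed

text \<open>By \<open>wave_distance\<close> the limit 1 says that the distance of each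
  \<open>wave t\<close> to the span of \<open>partial_spectrum m j\<close> tends to 0.\<close>

lemma orthonormal_basis_waves:
  assumes m: "odd m"
    and lim: "\<And>t. (\<lambda>j. \<Sum>l\<in>partial_spectrum m j. (norm (mu_hat (t + real l)))\<^sup>2) \<longlonglongrightarrow> 1"
  shows "orthonormal_basis_L2 \<mu> (Gamma_set m) (\<lambda>i. wave (real i))"
proof -
  let ?e = "\<lambda>i. wave (real i)"
  have fam: "square_integrable_family \<mu> (Gamma_set m) ?e"
    by unfold_locales (rule square_integrable_wave)
  have wave: "in_closed_span \<mu> (Gamma_set m) ?e (wave t)" for t
    unfolding in_closed_span_def
  proof (intro conjI allI impI square_integrable_wave)
    fix \<epsilon> :: real assume "\<epsilon> > 0"
    \<comment> \<open>The coefficients involve \<open>t - real l\<close>, while the limit concerns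
      shifts by \<open>+ real l\<close>; it is taken at \<open>- t\<close>, where
      \<open>mu_hat\<close> has the conjugate value.\<close>
    then obtain j where j: "(\<Sum>l\<in>partial_spectrum m j. (norm (mu_hat (- t + real l)))\<^sup>2) > 1 - \<epsilon>"
      using order_tendstoD(1)[OF lim[of "- t"], of "1 - \<epsilon>"] by (auto simp: eventually_sequentially)
    have "norm (mu_hat (- t + real l)) = norm (mu_hat (t - real l))" for l
      using mu_hat_minus[of "t - real l"] by (simp add: add.commute)
    then have *: "(\<Sum>l\<in>partial_spectrum m j. (norm (mu_hat (t - real l)))\<^sup>2) > 1 - \<epsilon>" using j by simp
    have sub: "partial_spectrum m j \<subseteq> Gamma_set m" by (auto simp: Gamma_set_eq)
    show "\<exists>F c. finite F \<and> F \<subseteq> Gamma_set m \<and>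
        (LINT x|\<mu>. (norm (wave t x - (\<Sum>i\<in>F. c i * wave (real i) x)))\<^sup>2) < \<epsilon>"
      using wave_distance[OF m sub, of t] * sub
      by (intro exI[of _ "partial_spectrum m j"] exI[of _ "\<lambda>i. mu_hat (t - real i)"]) auto
  qed
  show ?thesis
    unfolding orthonormal_basis_L2_def
  proof (intro conjI ballI allI impI)
    show "square_integrable \<mu> (wave (real i))" for i by (rule square_integrable_wave)
    show "L2_inner \<mu> (wave (real i)) (wave (real j)) = (if i = j then 1 else 0)"
      if "i \<in> Gamma_set m" "j \<in> Gamma_set m" for i j
      unfolding L2_inner_def integral_wave_mult_cnj using mu_hat_diff_Gamma_set[OF m that] .
    fix f :: "real \<Rightarrow> complex" and \<epsilon> :: real assume f: "square_integrable \<mu> f" and "\<epsilon> > 0"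
    have "in_closed_span \<mu> (Gamma_set m) ?e f"
      by (rule closed_span_total[OF fam indicator_in_closed_span[OF fam wave] f])
    \<comment> \<open>The closed span measures squared distance, hence
      \<open>\<epsilon>\<^sup>2\<close>.\<close>
    then obtain F c where F: "finite F" "F \<subseteq> Gamma_set m"
        "(LINT x|\<mu>. (norm (f x - (\<Sum>i\<in>F. c i * wave (real i) x)))\<^sup>2) < \<epsilon>\<^sup>2"
      using \<open>\<epsilon> > 0\<close> unfolding in_closed_span_def by (meson zero_less_power)
    from real_sqrt_less_mono[OF F(3)]
    have "L2_norm \<mu> (\<lambda>x. f x - (\<Sum>i\<in>F. c i * wave (real i) x)) < \<epsilon>"
      using \<open>\<epsilon> > 0\<close> by (simp add: L2_norm_def)
    then show "\<exists>F c. finite F \<and> F \<subseteq> Gamma_set m \<and> L2_norm \<mu> (\<lambda>x. f x - (\<Sum>i\<in>F. c i * wave (real i) x)) < \<epsilon>"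
      using F by blast
  qed
qed

end

theorem theorem2p9:
  fixes \<mu> :: "real measure" and p n :: nat
  assumes "invariant_measure \<mu>"
    and "prime p" and "p > 3"
  shows "complete_number \<mu> (p ^ n)"
proof -
  interpret self_similar_measure \<mu> by unfold_locales fact
  have "odd p" using assms(2,3) prime_odd_nat by auto
  then have odd: "odd (p ^ n)" by simp
  have "orthonormal_basis_L2 \<mu> (Gamma_set (p ^ n)) (\<lambda>i. wave (real i))"
    by (intro orthonormal_basis_waves sum_partial_spectrum_tendsto_one odd)
      (rule no_integer_extreme_cycle[OF assms(2,3)])
  moreover have "(\<lambda>\<gamma> x. exp (2 * of_real pi * \<i> * of_nat \<gamma> * of_real x)) = (\<lambda>i. wave (real i))"
    by (simp add: fun_eq_iff cis_conv_exp mult_ac)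
  ultimately show ?thesis unfolding complete_number_def by simp
qed

end
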